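(* If $r,s\ge 2$ with $(r,s)\ne(2,2)$, then $\mathrm{gp}^-(K_r\times K_s)=\min\{r,s,4\}$.
   Context: $K_r\times K_s$ is the direct product: vertex set $V(K_r)\times V(K_s)$, with $(g,h)\sim(g',h')$ iff $g\ne g'$ and $h\ne h'$. A set $S$ of vertices of a connected graph $G$ is a general position set if no shortest path contains three or more vertices of $S$; it is maximal if not properly contained in another general position set; $\mathrm{gp}^-(G)$ is the number of vertices in a smallest maximal general position set. *)

theory Defs
  imports "Graph_Theory.Graph_Theory"
begin

text \<open>
  Graphs are the symmetric, loop-free digraphs without parallel arcs of the locale \<^locale>\<open>graph\<close>;
  an undirected edge is the pair of its two orientations.  \<open>complete_digraph n G\<close> says that \<open>G\<close> is a
  complete graph on \<open>n\<close> vertices, i.e. a copy of \<open>K\<^sub>n\<close>.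
\<close>

definition direct_product ::
    "('a, 'b) pre_digraph \<Rightarrow> ('c, 'd) pre_digraph \<Rightarrow> ('a \<times> 'c) pair_pre_digraph" where
  "direct_product G H =
     \<lparr> pverts = verts G \<times> verts H,
       parcs = {((g, h), (g', h')) | g h g' h'. (g, g') \<in> arcs_ends G \<and> (h, h') \<in> arcs_ends H} \<rparr>"

definition shortest_path :: "('a, 'b) pre_digraph \<Rightarrow> 'a list \<Rightarrow> bool" where
  "shortest_path G p \<longleftrightarrow>
     vpath p G \<and>
     (\<forall>q. vpath q G \<and> hd q = hd p \<and> last q = last p \<longrightarrow> vwalk_length p \<le> vwalk_length q)"

definition general_position_set :: "('a, 'b) pre_digraph \<Rightarrow> 'a set \<Rightarrow> bool" where
  "general_position_set G S \<longleftrightarrow>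
     S \<subseteq> verts G \<and> \<not> (\<exists>p. shortest_path G p \<and> card (set p \<inter> S) \<ge> 3)"

definition maximal_general_position_set :: "('a, 'b) pre_digraph \<Rightarrow> 'a set \<Rightarrow> bool" where
  "maximal_general_position_set G S \<longleftrightarrow>
     general_position_set G S \<and> \<not> (\<exists>T. general_position_set G T \<and> S \<subset> T)"

definition lower_gp_number :: "('a, 'b) pre_digraph \<Rightarrow> nat" where
  "lower_gp_number G = (LEAST k. \<exists>S. maximal_general_position_set G S \<and> card S = k)"

text \<open>On finite graphs the minimum in \<^const>\<open>lower_gp_number\<close> ranges over a nonempty set.\<close>

lemma maximal_general_position_set_exists:
  assumes "finite (verts G)"
  shows "\<exists>S. maximal_general_position_set G S"
proof -
  let ?A = "{S. general_position_set G S}"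
  have "?A \<subseteq> Pow (verts G)"
    by (auto simp: general_position_set_def)
  then have "finite ?A"
    using assms by (meson finite_Pow_iff finite_subset)
  moreover have "{} \<in> ?A"
    by (simp add: general_position_set_def)
  ultimately obtain S where "S \<in> ?A" "\<forall>T\<in>?A. S \<subseteq> T \<longrightarrow> S = T"
    using finite_has_maximal[of ?A] by blast
  then have "maximal_general_position_set G S"
    unfolding maximal_general_position_set_def by blast
  then show ?thesis ..
qed

lemma parcs_direct_product_complete:
  assumes "complete_digraph r G" "complete_digraph s H"
  shows "((g, h), (g', h')) \<in> parcs (direct_product G H) \<longleftrightarrow>
    g \<in> verts G \<and> g' \<in> verts G \<and> h \<in> verts H \<and> h' \<in> verts H \<and> g \<noteq> g' \<and> h \<noteq> h'"
  using assms by (auto simp: direct_product_def complete_digraph_def)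

end

theory Submission
  imports Defs
begin

text \<open>
  If one factor is \<open>K\<^sub>2\<close>, two vertices differing only in that factor are at distance 3 and every
  other vertex lies on a geodesic between them, so they form a maximal general position set.
  Otherwise the product has diameter 2, and a set is in general position iff it induces a disjoint
  union of cliques. Full rows, full columns and the sets \<open>{a, c} \<times> {b, d}\<close> are then maximal.
  Conversely, a general position set with at most three vertices is a clique, lies on a line, or
  consists of three corners of some \<open>{a, c} \<times> {b, d}\<close>; in each case it can be extended as long as
  it is smaller than both factors.
\<close>

section \<open>General position sets and paths of length at most three\<close>

text \<open>Finiteness is required because \<open>card\<close> is 0 on infinite sets, so the bound
  alone would admit them.\<close>

lemma general_position_set_if_card_le_2:
  assumes "S \<subseteq> verts D" "finite S" "card S \<le> 2"
  shows "general_position_set D S"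
proof -
  have "card (set p \<inter> S) \<le> 2" for p
    using card_mono[of S "set p \<inter> S"] assms by auto
  then show ?thesis
    using assms(1) unfolding general_position_set_def by (metis Suc_n_not_le_n eval_nat_numeral(3) le_trans)
qed

lemma general_position_set_subset:
  assumes "general_position_set D S" "T \<subseteq> S"
  shows "general_position_set D T"
proof -
  have "card (set p \<inter> T) \<le> card (set p \<inter> S)" for p
    using assms(2) by (intro card_mono) auto
  then show ?thesis
    using assms order_trans unfolding general_position_set_def by blast
qed

lemma not_maximal_if_insert:
  assumes "general_position_set D (insert v S)" "v \<notin> S"
  shows "\<not> maximal_general_position_set D S"
  using assms unfolding maximal_general_position_set_def by blast

lemma maximal_general_position_setI:
  assumes "general_position_set D S"
    and "\<And>v T. v \<in> verts D \<Longrightarrow> v \<notin> S \<Longrightarrow> insert v S \<subseteq> T \<Longrightarrow> \<not> general_position_set D T"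
  shows "maximal_general_position_set D S"
  using assms unfolding maximal_general_position_set_def general_position_set_def by blast

lemma lower_gp_number_eqI:
  assumes "maximal_general_position_set D S" "card S = k"
    and "\<And>T. maximal_general_position_set D T \<Longrightarrow> k \<le> card T"
  shows "lower_gp_number D = k"
  unfolding lower_gp_number_def using assms by (intro Least_equality) auto

text \<open>A set with at most one vertex stays in general position after any vertex is added, since
  two vertices are too few to violate it.\<close>

lemma card_ge_2_if_maximal:
  assumes "maximal_general_position_set D S" "finite (verts D)" "card (verts D) \<ge> 2"
  shows "card S \<ge> 2"
proof (rule ccontr)
  assume small: "\<not> card S \<ge> 2"
  have sub: "S \<subseteq> verts D"
    using assms(1) by (auto simp: maximal_general_position_set_def general_position_set_def)
  then have fin: "finite S"
    using assms(2) finite_subset by blast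
  obtain v where "v \<in> verts D" "v \<notin> S"
    using small assms(3) sub by (metis subset_antisym subsetI)
  moreover from this have "general_position_set D (insert v S)"
    using sub fin small by (intro general_position_set_if_card_le_2) auto
  ultimately show False
    using not_maximal_if_insert[of D v S] assms(1) by simp
qed

text \<open>Lets vertices be counted instead of arcs, of which a path has one fewer.\<close>

lemma shortest_pathI:
  assumes "vpath p D"
    and "\<And>q. vpath q D \<Longrightarrow> hd q = hd p \<Longrightarrow> last q = last p \<Longrightarrow> length p \<le> length q"
  shows "shortest_path D p"
  using assms by (auto simp: shortest_path_def intro: diff_le_mono)

lemma vpath_two:
  "vpath [x, y] D \<longleftrightarrow> x \<in> verts D \<and> y \<in> verts D \<and> (x, y) \<in> arcs_ends D \<and> x \<noteq> y"
  by (auto simp: vpath_def vwalk_def)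

lemma vpath_three:
  "vpath [x, y, z] D \<longleftrightarrow> {x, y, z} \<subseteq> verts D \<and> (x, y) \<in> arcs_ends D \<and> (y, z) \<in> arcs_ends D \<and>
     distinct [x, y, z]"
  by (auto simp: vpath_def vwalk_def)

lemma vpath_length_ge_3:
  assumes "vpath q D" "hd q \<noteq> last q" "(hd q, last q) \<notin> arcs_ends D"
  shows "length q \<ge> 3"
proof (rule ccontr)
  assume "\<not> length q \<ge> 3"
  then have "length q = 0 \<or> length q = 1 \<or> length q = 2" by linarith
  then consider "q = []" | x where "q = [x]" | x y where "q = [x, y]"
    by (auto simp: length_Suc_conv numeral_2_eq_2)
  then show False
    using assms by cases (auto simp: vpath_two vpath_def vwalk_def)
qed

text \<open>The middle vertex of a path with three vertices would be joined to both ends; shorter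
  paths are excluded by \<open>vpath_length_ge_3\<close>.\<close>

lemma vpath_length_ge_4:
  assumes "vpath q D" "hd q \<noteq> last q" "(hd q, last q) \<notin> arcs_ends D"
    and "\<And>z. (hd q, z) \<in> arcs_ends D \<Longrightarrow> (z, last q) \<notin> arcs_ends D"
  shows "length q \<ge> 4"
proof (rule ccontr)
  assume "\<not> length q \<ge> 4"
  with vpath_length_ge_3[OF assms(1-3)] have "length q = 3" by linarith
  then obtain x y z where "q = [x, y, z]"
    by (auto simp: length_Suc_conv numeral_3_eq_3)
  then show False
    using assms by (auto simp: vpath_three)
qed

text \<open>The hypotheses put \<open>x\<close> and \<open>y\<close> at distance at least 3, so
  every path with four vertices between them is a geodesic, and \<open>geodesic\<close> places each
  further vertex on such a path. Both directions are spelled out because \<open>D\<close> is not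
  assumed symmetric.\<close>

lemma maximal_general_position_pair:
  assumes "x \<in> verts D" "y \<in> verts D" "x \<noteq> y"
    and nadj: "(x, y) \<notin> arcs_ends D" "(y, x) \<notin> arcs_ends D"
    and no_common: "\<And>z. (x, z) \<in> arcs_ends D \<Longrightarrow> (z, y) \<notin> arcs_ends D"
      "\<And>z. (y, z) \<in> arcs_ends D \<Longrightarrow> (z, x) \<notin> arcs_ends D"
    and geodesic: "\<And>v. v \<in> verts D \<Longrightarrow> v \<noteq> x \<Longrightarrow> v \<noteq> y \<Longrightarrow>
      \<exists>w. vpath [x, w, v, y] D \<or> vpath [y, w, v, x] D"
  shows "maximal_general_position_set D {x, y}"
proof (rule maximal_general_position_setI)
  show "general_position_set D {x, y}"
    using assms(1-3) by (intro general_position_set_if_card_le_2) auto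
next
  fix v T
  assume v: "v \<in> verts D" "v \<notin> {x, y}" and T: "insert v {x, y} \<subseteq> T"
  have False if "general_position_set D T" "vpath p D" "length p = 4"
    "{x, y, v} \<subseteq> set p" "hd p = x \<and> last p = y \<or> hd p = y \<and> last p = x" for p
  proof -
    have "4 \<le> length q" if "vpath q D" "hd q = hd p" "last q = last p" for q
      using \<open>hd p = x \<and> last p = y \<or> hd p = y \<and> last p = x\<close> that nadj no_common \<open>x \<noteq> y\<close>
      by (intro vpath_length_ge_4[of q D]) auto
    then have "shortest_path D p"
      using that by (intro shortest_pathI) auto
    moreover have "card {x, y, v} \<le> card (set p \<inter> T)"
      using T that by (intro card_mono) auto
    ultimately show False
      using that(1) v \<open>x \<noteq> y\<close> by (auto simp: general_position_set_def)
  qed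
  note not_on_geodesic = this
  obtain w where "vpath [x, w, v, y] D \<or> vpath [y, w, v, x] D"
    using geodesic[of v] v by auto
  then show "\<not> general_position_set D T"
    using not_on_geodesic[of "[x, w, v, y]"] not_on_geodesic[of "[y, w, v, x]"] by auto
qed

section \<open>Graphs of diameter two\<close>

text \<open>At diameter at most 2 a shortest path has at most three vertices, and those with exactly
  three are the paths \<open>[x, y, z]\<close> whose ends are distinct and nonadjacent. Forbidding
  them inside \<open>S\<close> makes adjacency transitive there, up to \<open>x = z\<close>; in a
  symmetric graph \<open>S\<close> then induces disjoint cliques.\<close>

lemma general_position_set_iff_diameter_2:
  assumes wf: "\<And>x y. (x, y) \<in> arcs_ends D \<Longrightarrow> x \<in> verts D \<and> y \<in> verts D \<and> x \<noteq> y"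
    and diam: "\<And>x y. x \<in> verts D \<Longrightarrow> y \<in> verts D \<Longrightarrow> x \<noteq> y \<Longrightarrow> (x, y) \<notin> arcs_ends D \<Longrightarrow>
      \<exists>z. (x, z) \<in> arcs_ends D \<and> (z, y) \<in> arcs_ends D"
  shows "general_position_set D S \<longleftrightarrow>
    S \<subseteq> verts D \<and>
    (\<forall>x\<in>S. \<forall>y\<in>S. \<forall>z\<in>S. (x, y) \<in> arcs_ends D \<longrightarrow> (y, z) \<in> arcs_ends D \<longrightarrow> x \<noteq> z \<longrightarrow>
       (x, z) \<in> arcs_ends D)"
    (is "_ \<longleftrightarrow> _ \<and> ?R")
proof -
  have "shortest_path D [x, y, z]"
    if "(x, y) \<in> arcs_ends D" "(y, z) \<in> arcs_ends D" "x \<noteq> z" "(x, z) \<notin> arcs_ends D" for x y z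
  proof (rule shortest_pathI)
    show "vpath [x, y, z] D"
      using that wf[of x y] wf[of y z] by (auto simp: vpath_three)
    show "length [x, y, z] \<le> length q"
      if "vpath q D" "hd q = hd [x, y, z]" "last q = last [x, y, z]" for q
      using vpath_length_ge_3[OF that(1)] that \<open>x \<noteq> z\<close> \<open>(x, z) \<notin> arcs_ends D\<close> by simp
  qed
  moreover have "card (set [x, y, z] \<inter> S) = 3"
    if "(x, y) \<in> arcs_ends D" "(y, z) \<in> arcs_ends D" "x \<noteq> z" "x \<in> S" "y \<in> S" "z \<in> S" for x y z
  proof -
    have "set [x, y, z] \<inter> S = {x, y, z}" using that by auto
    then show ?thesis using that wf[of x y] wf[of y z] by auto
  qed
  ultimately have fwd: "?R" if "general_position_set D S"
    using that unfolding general_position_set_def by (metis order_refl)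
  have bwd: False if "?R" "shortest_path D p" "card (set p \<inter> S) \<ge> 3" for p
  proof -
    have p: "vpath p D" and
      min: "\<And>q. vpath q D \<Longrightarrow> hd q = hd p \<Longrightarrow> last q = last p \<Longrightarrow> length p - 1 \<le> length q - 1"
      using that(2) by (auto simp: shortest_path_def)
    have "3 \<le> length p"
      using that(3) card_mono[of "set p" "set p \<inter> S"] card_length[of p] by force
    have "p \<noteq> []" "distinct p" "set p \<subseteq> verts D"
      using p by (auto simp: vpath_def vwalk_def)
    have ends: "hd p \<in> verts D" "last p \<in> verts D" "hd p \<noteq> last p"
      using \<open>p \<noteq> []\<close> \<open>distinct p\<close> \<open>set p \<subseteq> verts D\<close> \<open>3 \<le> length p\<close>
      by (auto simp: subset_iff hd_conv_nth last_conv_nth nth_eq_iff_index_eq)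
    \<comment> \<open>An arc between the ends is excluded as a shorter path. The two-arc path
      supplied by \<open>diam\<close> then forces \<open>p\<close> to have exactly three
      vertices.\<close>
    have nadj: "(hd p, last p) \<notin> arcs_ends D"
    proof
      assume "(hd p, last p) \<in> arcs_ends D"
      then have "vpath [hd p, last p] D"
        using ends by (simp add: vpath_two)
      from min[OF this] \<open>3 \<le> length p\<close> show False by simp
    qed
    from diam[OF ends this] obtain z where z: "(hd p, z) \<in> arcs_ends D" "(z, last p) \<in> arcs_ends D"
      by blast
    then have "vpath [hd p, z, last p] D"
      using ends wf[of "hd p" z] wf[of z "last p"] by (auto simp: vpath_three)
    from min[OF this] \<open>3 \<le> length p\<close> have "length p = 3" by simp
    then obtain a b c where abc: "p = [a, b, c]"
      by (auto simp: length_Suc_conv numeral_3_eq_3)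
    \<comment> \<open>The path has only three entries and meets \<open>S\<close> in three vertices,
      so it lies entirely in \<open>S\<close>.\<close>
    have "card (set p \<inter> S) \<ge> card (set p)"
      using that(3) card_length[of p] \<open>length p = 3\<close> by linarith
    then have "set p \<inter> S = set p"
      by (intro card_seteq) auto
    then have "a \<in> S" "b \<in> S" "c \<in> S"
      using abc by auto
    moreover have "(a, b) \<in> arcs_ends D" "(b, c) \<in> arcs_ends D" "a \<noteq> c"
      using p by (auto simp: abc vpath_three)
    moreover have "(a, c) \<notin> arcs_ends D"
      using nadj by (simp add: abc)
    ultimately show False
      using that(1) by blast
  qed
  show ?thesis
  proof
    assume gp: "general_position_set D S"
    then have "S \<subseteq> verts D"
      by (simp add: general_position_set_def)
    then show "S \<subseteq> verts D \<and> ?R"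
      using fwd[OF gp] by (rule conjI)
  next
    assume "S \<subseteq> verts D \<and> ?R"
    then have sub: "S \<subseteq> verts D" and R: ?R
      by (rule conjunct1, rule conjunct2)
    show "general_position_set D S"
      unfolding general_position_set_def using sub bwd[OF R] by blast
  qed
qed

section \<open>Direct products of complete graphs\<close>

text \<open>Used to choose a coordinate that avoids two given ones, which may coincide.\<close>

lemma third_element:
  assumes "card X \<ge> 3"
  obtains w where "w \<in> X" "w \<noteq> u" "w \<noteq> v"
proof -
  have "\<not> X \<subseteq> {u, v}"
    using card_mono[of "{u, v}" X] assms card_insert_le_m1[of 2 "{v}" u] by force
  then show ?thesis
    using that by blast
qed

text \<open>Only the vertex set and the adjacency of the product are kept, so that the arguments
  below deal with coordinates alone.\<close>

locale complete_product =
  fixes D :: "('a \<times> 'c, 'e) pre_digraph" and A :: "'a set" and B :: "'c set"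
  assumes finite_factors: "finite A" "finite B"
    and verts_eq: "verts D = A \<times> B"
    and adj_iff: "\<And>g h g' h'. ((g, h), (g', h')) \<in> arcs_ends D \<longleftrightarrow>
      g \<in> A \<and> g' \<in> A \<and> h \<in> B \<and> h' \<in> B \<and> g \<noteq> g' \<and> h \<noteq> h'"
begin

section \<open>Antipodal pairs when one factor has two vertices\<close>

lemma maximal_antipodal_pair_right:
  assumes "card A \<ge> 3" "card B = 2" "g \<in> A"
  shows "maximal_general_position_set D ({g} \<times> B)"
proof -
  obtain h h' where B: "B = {h, h'}" "h \<noteq> h'"
    using assms(2) by (auto simp: card_2_iff)
  \<comment> \<open>A common neighbour would need a second coordinate other than \<open>h\<close>
    and \<open>h'\<close>, and \<open>B\<close> has none.\<close>
  have "maximal_general_position_set D {(g, h), (g, h')}"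
  proof (rule maximal_general_position_pair)
    fix v assume "v \<in> verts D" "v \<noteq> (g, h)" "v \<noteq> (g, h')"
    then obtain a b where v: "v = (a, b)" "a \<in> A" "a \<noteq> g" "b = h \<or> b = h'"
      using B by (auto simp: verts_eq)
    obtain c where "c \<in> A" "c \<noteq> g" "c \<noteq> a"
      using third_element[OF assms(1)] by blast
    \<comment> \<open>The vertex \<open>v\<close> comes third, so the path starts at the end of the
      pair that shares the second coordinate \<open>b\<close> with \<open>v\<close>. Both the start
      and \<open>v\<close> are adjacent to the witness: \<open>c\<close> avoids their first
      coordinates, and the other element of \<open>B\<close> avoids \<open>b\<close>.\<close>
    then show "\<exists>w. vpath [(g, h), w, v, (g, h')] D \<or> vpath [(g, h'), w, v, (g, h)] D"
      using v B assms(3)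
      by (intro exI[of _ "(c, if b = h then h' else h)"]) (auto simp: vpath_def vwalk_def verts_eq adj_iff)
  qed (use assms(3) B in \<open>auto simp: verts_eq adj_iff\<close>)
  moreover have "{g} \<times> B = {(g, h), (g, h')}"
    using B by auto
  ultimately show ?thesis by simp
qed

lemma maximal_antipodal_pair_left:
  assumes "card A = 2" "card B \<ge> 3" "h \<in> B"
  shows "maximal_general_position_set D (A \<times> {h})"
proof -
  obtain g g' where A: "A = {g, g'}" "g \<noteq> g'"
    using assms(1) by (auto simp: card_2_iff)
  have "maximal_general_position_set D {(g, h), (g', h)}"
  proof (rule maximal_general_position_pair)
    fix v assume "v \<in> verts D" "v \<noteq> (g, h)" "v \<noteq> (g', h)"
    then obtain a b where v: "v = (a, b)" "b \<in> B" "b \<noteq> h" "a = g \<or> a = g'"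
      using A by (auto simp: verts_eq)
    obtain d where "d \<in> B" "d \<noteq> h" "d \<noteq> b"
      using third_element[OF assms(2)] by blast
    then show "\<exists>w. vpath [(g, h), w, v, (g', h)] D \<or> vpath [(g', h), w, v, (g, h)] D"
      using v A assms(3)
      by (intro exI[of _ "(if a = g then g' else g, d)"]) (auto simp: vpath_def vwalk_def verts_eq adj_iff)
  qed (use assms(3) A in \<open>auto simp: verts_eq adj_iff\<close>)
  moreover have "A \<times> {h} = {(g, h), (g', h)}"
    using A by auto
  ultimately show ?thesis by simp
qed

section \<open>Factors with at least three vertices: general position and maximal sets\<close>

lemma general_position_set_iff:
  assumes "card A \<ge> 3" "card B \<ge> 3"
  shows "general_position_set D S \<longleftrightarrow>
    S \<subseteq> A \<times> B \<and>
    (\<forall>x\<in>S. \<forall>y\<in>S. \<forall>z\<in>S. (x, y) \<in> arcs_ends D \<longrightarrow> (y, z) \<in> arcs_ends D \<longrightarrow> x \<noteq> z \<longrightarrow>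
       (x, z) \<in> arcs_ends D)"
proof -
  have "\<exists>z. (x, z) \<in> arcs_ends D \<and> (z, y) \<in> arcs_ends D" if "x \<in> verts D" "y \<in> verts D" for x y
  proof -
    \<comment> \<open>A third element in each factor avoids the coordinates of both vertices and
      gives a common neighbour, so the diameter is at most 2.\<close>
    obtain c d where "c \<in> A" "c \<noteq> fst x" "c \<noteq> fst y" "d \<in> B" "d \<noteq> snd x" "d \<noteq> snd y"
      using third_element[OF assms(1)] third_element[OF assms(2)] by metis
    then show ?thesis
      using that by (intro exI[of _ "(c, d)"]) (auto simp: verts_eq adj_iff)
  qed
  then show ?thesis
    unfolding verts_eq[symmetric]
    by (intro general_position_set_iff_diameter_2) (auto simp: verts_eq adj_iff)
qed

lemma general_position_if_independent:
  assumes "card A \<ge> 3" "card B \<ge> 3" "S \<subseteq> A \<times> B"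
    and "\<And>x y. x \<in> S \<Longrightarrow> y \<in> S \<Longrightarrow> (x, y) \<notin> arcs_ends D"
  shows "general_position_set D S"
  using assms(3-) unfolding general_position_set_iff[OF assms(1,2)] by blast

lemma not_general_position_if_induced_path:
  assumes "card A \<ge> 3" "card B \<ge> 3" "{x, y, z} \<subseteq> T"
    and "(x, y) \<in> arcs_ends D" "(y, z) \<in> arcs_ends D" "x \<noteq> z" "(x, z) \<notin> arcs_ends D"
  shows "\<not> general_position_set D T"
  using assms(3-) unfolding general_position_set_iff[OF assms(1,2)] by blast

text \<open>An outside vertex \<open>(a, b)\<close> is adjacent to every \<open>(g, d)\<close> with
  \<open>d\<close> different from \<open>b\<close>. As \<open>B\<close> has three elements, there
  are two of these; they share a row, so they are nonadjacent and an induced path arises.\<close>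

lemma maximal_row:
  assumes "card A \<ge> 3" "card B \<ge> 3" "g \<in> A"
  shows "maximal_general_position_set D ({g} \<times> B)"
proof (rule maximal_general_position_setI)
  show "general_position_set D ({g} \<times> B)"
    using assms by (intro general_position_if_independent) (auto simp: adj_iff)
next
  fix v T
  assume "v \<in> verts D" "v \<notin> {g} \<times> B" and T: "insert v ({g} \<times> B) \<subseteq> T"
  then obtain a b where v: "v = (a, b)" "a \<in> A" "a \<noteq> g" "b \<in> B"
    by (auto simp: verts_eq)
  obtain d where d: "d \<in> B" "d \<noteq> b"
    using third_element[OF assms(2)] by blast
  obtain e where e: "e \<in> B" "e \<noteq> b" "e \<noteq> d"
    using third_element[OF assms(2)] by blast
  show "\<not> general_position_set D T"
    by (rule not_general_position_if_induced_path[OF assms(1,2), of "(g, d)" v "(g, e)"])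
      (use v d e T assms(3) in \<open>auto simp: adj_iff\<close>)
qed

lemma maximal_column:
  assumes "card A \<ge> 3" "card B \<ge> 3" "h \<in> B"
  shows "maximal_general_position_set D (A \<times> {h})"
proof (rule maximal_general_position_setI)
  show "general_position_set D (A \<times> {h})"
    using assms by (intro general_position_if_independent) (auto simp: adj_iff)
next
  fix v T
  assume "v \<in> verts D" "v \<notin> A \<times> {h}" and T: "insert v (A \<times> {h}) \<subseteq> T"
  then obtain a b where v: "v = (a, b)" "b \<in> B" "b \<noteq> h" "a \<in> A"
    by (auto simp: verts_eq)
  obtain d where d: "d \<in> A" "d \<noteq> a"
    using third_element[OF assms(1)] by blast
  obtain e where e: "e \<in> A" "e \<noteq> a" "e \<noteq> d"
    using third_element[OF assms(1)] by blast
  show "\<not> general_position_set D T"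
    by (rule not_general_position_if_induced_path[OF assms(1,2), of "(d, h)" v "(e, h)"])
      (use v d e T assms(3) in \<open>auto simp: adj_iff\<close>)
qed

text \<open>A corner can be adjacent only to the opposite corner, so a walk of two steps inside the
  rectangle returns to its start.\<close>

lemma general_position_rectangle:
  assumes "card A \<ge> 3" "card B \<ge> 3" "a \<in> A" "c \<in> A" "b \<in> B" "d \<in> B"
  shows "general_position_set D ({a, c} \<times> {b, d})"
proof -
  have "x = z"
    if "x \<in> {a, c} \<times> {b, d}" "y \<in> {a, c} \<times> {b, d}" "z \<in> {a, c} \<times> {b, d}"
      "(x, y) \<in> arcs_ends D" "(y, z) \<in> arcs_ends D" for x y z
    using that by (cases x; cases y; cases z) (auto simp: adj_iff)
  moreover have "{a, c} \<times> {b, d} \<subseteq> A \<times> B"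
    using assms(3-) by auto
  ultimately show ?thesis
    unfolding general_position_set_iff[OF assms(1,2)] by blast
qed

lemma maximal_rectangle:
  assumes "card A \<ge> 3" "card B \<ge> 3" "a \<in> A" "c \<in> A" "a \<noteq> c" "b \<in> B" "d \<in> B" "b \<noteq> d"
  shows "maximal_general_position_set D ({a, c} \<times> {b, d})"
proof (rule maximal_general_position_setI)
  show "general_position_set D ({a, c} \<times> {b, d})"
    using assms by (intro general_position_rectangle)
next
  fix v T
  assume "v \<in> verts D" and out: "v \<notin> {a, c} \<times> {b, d}" and T: "insert v ({a, c} \<times> {b, d}) \<subseteq> T"
  then obtain x y where v: "v = (x, y)" "x \<in> A" "y \<in> B"
    by (auto simp: verts_eq)
  show "\<not> general_position_set D T"
  proof (cases "x \<in> {a, c}")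
    case True
    \<comment> \<open>Since \<open>v\<close> is outside, \<open>y\<close> differs from
      \<open>b\<close> and \<open>d\<close>, so \<open>v\<close> is adjacent to both corners in the
      other row.\<close>
    then obtain x' where "x' \<in> {a, c}" "x' \<noteq> x"
      using assms(5) by blast
    then show ?thesis
      by (intro not_general_position_if_induced_path[OF assms(1,2), of "(x', b)" v "(x', d)"])
        (use True v out T assms(3-) in \<open>auto simp: adj_iff\<close>)
  next
    case False
    \<comment> \<open>Now \<open>x\<close> differs from \<open>a\<close> and \<open>c\<close>, so
      \<open>v\<close> is adjacent to both corners in column \<open>y'\<close>.\<close>
    obtain y' where "y' \<in> {b, d}" "y' \<noteq> y"
      using assms(8) by blast
    with False show ?thesis
      by (intro not_general_position_if_induced_path[OF assms(1,2), of "(a, y')" v "(c, y')"])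
        (use v T assms(3-) in \<open>auto simp: adj_iff\<close>)
  qed
qed

section \<open>Extending small general position sets\<close>

lemma extend_clique:
  assumes "card A \<ge> 3" "card B \<ge> 3" "S \<subseteq> A \<times> B" "card S < card A" "card S < card B"
    and clique: "\<And>x y. x \<in> S \<Longrightarrow> y \<in> S \<Longrightarrow> x \<noteq> y \<Longrightarrow> (x, y) \<in> arcs_ends D"
  shows "\<exists>v. v \<notin> S \<and> general_position_set D (insert v S)"
proof -
  have "finite S"
    using finite_subset[OF assms(3)] finite_factors by simp
  \<comment> \<open>Having fewer vertices than either factor, \<open>S\<close> misses a row and a
    column. The vertex where these meet is adjacent to all of \<open>S\<close> and enlarges the
    clique.\<close>
  then have "\<not> A \<subseteq> fst ` S" "\<not> B \<subseteq> snd ` S"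
    using assms(4,5) surj_card_le[of S A fst] surj_card_le[of S B snd] by linarith+
  then obtain a b where new: "a \<in> A" "a \<notin> fst ` S" "b \<in> B" "b \<notin> snd ` S"
    by blast
  have "((a, b), x) \<in> arcs_ends D \<and> (x, (a, b)) \<in> arcs_ends D" if "x \<in> S" for x
    using that new assms(3) by (cases x) (force simp: adj_iff)
  then have "general_position_set D (insert (a, b) S)"
    unfolding general_position_set_iff[OF assms(1,2)] using assms(3) new clique
    by (intro conjI ballI impI) (auto simp del: split_paired_All)
  moreover have "(a, b) \<notin> S"
    using new by force
  ultimately show ?thesis by blast
qed

text \<open>Any missing vertex of the row works, because the full row is in general position and
  subsets inherit this.\<close>

lemma extend_in_row:
  assumes "card A \<ge> 3" "card B \<ge> 3" "a \<in> A" "S \<subseteq> {a} \<times> B" "card S < card B"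
  shows "\<exists>v. v \<notin> S \<and> general_position_set D (insert v S)"
proof -
  have "\<not> {a} \<times> B \<subseteq> S"
    using assms(4,5) card_mono[of "S" "{a} \<times> B"] finite_subset[OF assms(4)] finite_factors
    by (auto simp: card_cartesian_product_singleton)
  then obtain b where "b \<in> B" "(a, b) \<notin> S"
    by blast
  moreover from this have "general_position_set D (insert (a, b) S)"
    using assms(4) maximal_row[OF assms(1-3)] general_position_set_subset[of D "{a} \<times> B"]
    by (simp add: maximal_general_position_set_def)
  ultimately show ?thesis by blast
qed

lemma extend_in_column:
  assumes "card A \<ge> 3" "card B \<ge> 3" "b \<in> B" "S \<subseteq> A \<times> {b}" "card S < card A"
  shows "\<exists>v. v \<notin> S \<and> general_position_set D (insert v S)"
proof -
  have "\<not> A \<times> {b} \<subseteq> S"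
    using assms(4,5) card_mono[of "S" "A \<times> {b}"] finite_subset[OF assms(4)] finite_factors
    by (auto simp: card_cartesian_product)
  then obtain a where "a \<in> A" "(a, b) \<notin> S"
    by blast
  moreover from this have "general_position_set D (insert (a, b) S)"
    using assms(4) maximal_column[OF assms(1-3)] general_position_set_subset[of D "A \<times> {b}"]
    by (simp add: maximal_general_position_set_def)
  ultimately show ?thesis by blast
qed

lemma extend_in_rectangle:
  assumes "card A \<ge> 3" "card B \<ge> 3" "a \<in> A" "c \<in> A" "a \<noteq> c" "b \<in> B" "d \<in> B" "b \<noteq> d"
    and "S \<subseteq> {a, c} \<times> {b, d}" "card S = 3"
  shows "\<exists>v. v \<notin> S \<and> general_position_set D (insert v S)"
proof -
  have R: "card ({a, c} \<times> {b, d}) = 4"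
    using assms(5,8) by (simp add: card_cartesian_product)
  have "finite S"
    using assms(10) by (auto intro: card_ge_0_finite)
  then have "card ({a, c} \<times> {b, d} - S) = 1"
    using R assms(9,10) by (simp add: card_Diff_subset)
  then obtain v where "{a, c} \<times> {b, d} - S = {v}"
    by (auto simp: card_1_singleton_iff)
  then have "v \<notin> S" "insert v S = {a, c} \<times> {b, d}"
    using assms(9) by auto
  then show ?thesis
    using general_position_rectangle[OF assms(1-4,6,7)] by metis
qed

lemma extend_small:
  assumes large: "card A \<ge> 3" "card B \<ge> 3"
    and gp: "general_position_set D S"
    and small: "card S \<le> 3" "card S < card A" "card S < card B"
  shows "\<exists>v. v \<notin> S \<and> general_position_set D (insert v S)"
proof -
  have sub: "S \<subseteq> A \<times> B" and
    cluster: "\<And>x y z. x \<in> S \<Longrightarrow> y \<in> S \<Longrightarrow> z \<in> S \<Longrightarrow> (x, y) \<in> arcs_ends D \<Longrightarrow>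
      (y, z) \<in> arcs_ends D \<Longrightarrow> x \<noteq> z \<Longrightarrow> (x, z) \<in> arcs_ends D"
    using gp unfolding general_position_set_iff[OF large] by blast+
  have fin: "finite S"
    using finite_subset[OF sub] finite_factors by simp
  \<comment> \<open>By the bound on \<open>card S\<close>, three distinct elements exhaust
    \<open>S\<close>; this identifies \<open>S\<close> when it is neither a clique nor contained in
    a line.\<close>
  have three: "S = {x, y, z}" "card S = 3"
    if "x \<in> S" "y \<in> S" "z \<in> S" "x \<noteq> y" "x \<noteq> z" "y \<noteq> z" for x y z
  proof -
    have "card {x, y, z} = 3"
      using that by simp
    then show "S = {x, y, z}"
      using card_seteq[OF fin, of "{x, y, z}"] that small(1) by auto
    with \<open>card {x, y, z} = 3\<close> show "card S = 3"
      by simp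
  qed
  \<comment> \<open>Distinct nonadjacent vertices share a coordinate, so a set that is not a clique
    has two vertices in one row or in one column.\<close>
  consider (clique) "\<And>x y. x \<in> S \<Longrightarrow> y \<in> S \<Longrightarrow> x \<noteq> y \<Longrightarrow> (x, y) \<in> arcs_ends D"
    | (row) a b b' where "(a, b) \<in> S" "(a, b') \<in> S" "b \<noteq> b'"
    | (column) a a' b where "(a, b) \<in> S" "(a', b) \<in> S" "a \<noteq> a'"
  proof (cases "\<forall>x\<in>S. \<forall>y\<in>S. x \<noteq> y \<longrightarrow> (x, y) \<in> arcs_ends D")
    case True
    then show ?thesis
      using clique by blast
  next
    case False
    then obtain a b a' b' where "(a, b) \<in> S" "(a', b') \<in> S" "(a, b) \<noteq> (a', b')"
      "((a, b), (a', b')) \<notin> arcs_ends D"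
      by auto
    moreover from this have "a = a' \<or> b = b'"
      using sub by (auto simp: adj_iff)
    ultimately show ?thesis
      using row[of a b b'] column[of a b a'] by blast
  qed
  then show ?thesis
  proof cases
    case clique
    then show ?thesis
      using extend_clique[OF large sub small(2,3)] by blast
  next
    case row
    then have in_factors: "a \<in> A" "b \<in> B" "b' \<in> B"
      using sub by auto
    show ?thesis
    proof (cases "S \<subseteq> {a} \<times> B")
      case True
      then show ?thesis
        using extend_in_row[OF large in_factors(1)] small(3) by blast
    next
      case False
      then obtain c d where z: "(c, d) \<in> S" "c \<in> A" "c \<noteq> a" "d \<in> B"
        using sub by blast
      \<comment> \<open>Otherwise \<open>(c, d)\<close> would be adjacent to both
        \<open>(a, b)\<close> and \<open>(a, b')\<close>, which are nonadjacent, contrary to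
        \<open>cluster\<close>. Hence \<open>S\<close> consists of three corners of a
        rectangle.\<close>
      have "d = b \<or> d = b'"
        using cluster[of "(a, b)" "(c, d)" "(a, b')"] row z in_factors by (auto simp: adj_iff)
      moreover have "S = {(a, b), (a, b'), (c, d)}" "card S = 3"
        using three[of "(a, b)" "(a, b')" "(c, d)"] row z by auto
      ultimately show ?thesis
        using extend_in_rectangle[OF large, of a c b b' S] row z in_factors by auto
    qed
  next
    case column
    then have in_factors: "a \<in> A" "a' \<in> A" "b \<in> B"
      using sub by auto
    show ?thesis
    proof (cases "S \<subseteq> A \<times> {b}")
      case True
      then show ?thesis
        using extend_in_column[OF large in_factors(3)] small(2) by blast
    next
      case False
      then obtain c d where z: "(c, d) \<in> S" "c \<in> A" "d \<noteq> b" "d \<in> B"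
        using sub by blast
      have "c = a \<or> c = a'"
        using cluster[of "(a, b)" "(c, d)" "(a', b)"] column z in_factors by (auto simp: adj_iff)
      moreover have "S = {(a, b), (a', b), (c, d)}" "card S = 3"
        using three[of "(a, b)" "(a', b)" "(c, d)"] column z by auto
      ultimately show ?thesis
        using extend_in_rectangle[OF large, of a a' b d S] column z in_factors by auto
    qed
  qed
qed

section \<open>Values of the lower general position number\<close>

lemma lower_gp_number_eq_2:
  assumes "card A \<ge> 3 \<and> card B = 2 \<or> card A = 2 \<and> card B \<ge> 3"
  shows "lower_gp_number D = 2"
proof -
  obtain S where "maximal_general_position_set D S" "card S = 2"
  proof -
    obtain g h where "g \<in> A" "h \<in> B"
      using assms by (metis card.empty ex_in_conv not_numeral_le_zero zero_neq_numeral)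
    then show ?thesis
      using assms that[of "{g} \<times> B"] that[of "A \<times> {h}"]
        maximal_antipodal_pair_right maximal_antipodal_pair_left
      by (auto simp: card_cartesian_product)
  qed
  moreover have "card A * card B \<ge> 1 * 2"
    using assms by (intro mult_le_mono) auto
  then have "2 \<le> card T" if "maximal_general_position_set D T" for T
    using card_ge_2_if_maximal[OF that] finite_factors by (simp add: verts_eq card_cartesian_product)
  ultimately show ?thesis
    by (rule lower_gp_number_eqI)
qed

lemma lower_gp_number_eq_Min:
  assumes large: "card A \<ge> 3" "card B \<ge> 3"
  shows "lower_gp_number D = Min {card A, card B, 4}"
proof -
  let ?k = "Min {card A, card B, 4}"
  obtain S where "maximal_general_position_set D S" "card S = ?k"
  proof -
    obtain a b where ab: "a \<in> A" "b \<in> B"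
      using third_element[OF large(1)] third_element[OF large(2)] by metis
    obtain c d where cd: "c \<in> A" "a \<noteq> c" "d \<in> B" "b \<noteq> d"
      using third_element[OF large(1)] third_element[OF large(2)] by metis
    \<comment> \<open>Each candidate for the minimum is the size of a maximal set: a full column, a
      full row, or a rectangle.\<close>
    consider "?k = card A" | "?k = card B" | "?k = 4"
      using Min_in[of "{card A, card B, 4}"] by blast
    then show ?thesis
    proof cases
      case 1
      then show ?thesis
        using that[OF maximal_column[OF large ab(2)]] by (simp add: card_cartesian_product)
    next
      case 2
      then show ?thesis
        using that[OF maximal_row[OF large ab(1)]] by (simp add: card_cartesian_product)
    next
      case 3
      then show ?thesis
        using that[OF maximal_rectangle[OF large ab(1) cd(1,2) ab(2) cd(3,4)]] cd
        by (simp add: card_cartesian_product)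
    qed
  qed
  moreover have "?k \<le> card T" if "maximal_general_position_set D T" for T
  proof (rule ccontr)
    assume "\<not> ?k \<le> card T"
    \<comment> \<open>Lying below the minimum gives exactly the size bounds of
      \<open>extend_small\<close>.\<close>
    then have "card T \<le> 3" "card T < card A" "card T < card B"
      by auto
    moreover have "general_position_set D T"
      using that by (simp add: maximal_general_position_set_def)
    ultimately show False
      using extend_small[OF large, of T] not_maximal_if_insert[of D _ T] that by auto
  qed
  ultimately show ?thesis
    by (rule lower_gp_number_eqI)
qed

end

theorem theorem5p4:
  fixes G :: "('a, 'b) pre_digraph" and H :: "('c, 'd) pre_digraph" and r s :: nat
  assumes "complete_digraph r G" and "complete_digraph s H"
    and "r \<ge> 2" and "s \<ge> 2" and "(r, s) \<noteq> (2, 2)"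
  shows "lower_gp_number (with_proj (direct_product G H)) = Min {r, s, 4}"
proof -
  have card: "card (verts G) = r" "card (verts H) = s"
    using assms(1,2) by (auto simp: complete_digraph_def)
  interpret complete_product "with_proj (direct_product G H)" "verts G" "verts H"
  proof
    \<comment> \<open>An infinite vertex set would have \<open>card\<close> equal to 0, but
      \<open>r\<close> and \<open>s\<close> are positive.\<close>
    show "finite (verts G)" "finite (verts H)"
      using card assms(3,4) by (auto intro: card_ge_0_finite)
  qed (simp_all add: parcs_direct_product_complete[OF assms(1,2)], simp add: direct_product_def)
  show ?thesis
  proof (cases "r \<ge> 3 \<and> s \<ge> 3")
    case True
    then show ?thesis
      using lower_gp_number_eq_Min card by simp
  next
    case False
    \<comment> \<open>With \<open>(2, 2)\<close> excluded, exactly one factor has order 2, which is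
      then the minimum.\<close>
    then have "r \<ge> 3 \<and> s = 2 \<or> r = 2 \<and> s \<ge> 3"
      using assms(3-5) by auto
    then show ?thesis
      using lower_gp_number_eq_2 card by auto
  qed
qed

end
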